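(* Let $\Omega\subseteq\mathbb R^2$ be open and connected, $a>0$, $\kappa_1>1$, $x_0\in\Omega$. Given $\rho\in C^3(\Omega)$ with $0<\rho<a$, and ${\bf e}(x)=(0,0,1)$ for all $x\in\Omega$, let ${\bf m}$, $d$, $\Delta$ be as defined in the context and let $h$ be a function with $\nabla h=(e_1,e_2)=(0,0)$ on $\Omega$. Then the condition $$\det\Big(D^2h+(1-\kappa_1{\bf e}\cdot{\bf m})D^2\rho-\kappa_1\big(D\rho\otimes({\bf m}D{\bf e})+({\bf m}D{\bf e})\otimes D\rho\big)-\kappa_1\rho\big(D({\bf m}D{\bf e})-D{\bf e}\otimes D{\bf m}\big)+\kappa_1 d\,D{\bf m}\otimes D{\bf m}\Big)\neq0$$ is satisfied at $x_0$ if and only if $\det D^2\rho\neq0$ and $$\det\left(I+\frac{\kappa_1^2-1}{\kappa_1^2}D\rho\otimes D\rho+\frac{(a-\rho)(1-\kappa_1^2)}{\kappa_1^2+\Delta}D^2\rho\right)\neq0$$ at $x_0$.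
   Context: Notation. Vectors are row vectors. If $A$ is an $m\times n$ matrix and $B$ an $m\times p$ matrix, $A\otimes B=A^tB$. For ${\bf F}=(F_1,\dots,F_m)$ a $C^1$ field on an open subset of $\mathbb R^n$, $D{\bf F}=(\partial F_k/\partial x_i)_{1\le k\le m,1\le i\le n}$ (for scalar $\rho$, $D\rho$ is the row gradient and $D^2\rho$ the Hessian). $I$ is the $2\times2$ identity. Setting. Vertical rays with direction ${\bf e}=(0,0,1)$ issued from $(x,0)$, $x\in\Omega$, strike the graph $\sigma_1=\{(x,\rho(x)):x\in\Omega\}$, whose upward unit normal is $\nu(x)=\dfrac{(-D\rho(x),1)}{\sqrt{1+|D\rho(x)|^2}}$, and which separates media with ratio of refractive indices (above over below) $\kappa_1>1$. The refracted unit direction is, by Snell's law, $${\bf m}(x)=\frac1{\kappa_1}({\bf e}-\lambda\nu(x))=(m_1(x),m_2(x),m_3(x)),\qquad \lambda={\bf e}\cdot\nu(x)-\sqrt{\kappa_1^2-1+({\bf e}\cdot\nu(x))^2},$$ $d(x)=\dfrac{a-\rho(x)}{m_3(x)}$ is the distance travelled by the refracted ray until it meets the plane $\{x_3=a\}$, and $$\Delta(x)=\sqrt{\kappa_1^2+(\kappa_1^2-1)|D\rho(x)|^2}.$$ *)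

theory Defs
  imports "HOL-Analysis.Analysis"
begin

text \<open>Row gradient of a scalar function; its Jacobian (with entry (k,i) the i-th partial derivative
  of the k-th component) is the Hessian.\<close>

definition grad :: "(real^'n \<Rightarrow> real) \<Rightarrow> real^'n \<Rightarrow> real^'n" where
  "grad f x = (\<chi> i. frechet_derivative f (at x) (axis i 1))"

definition hessian :: "(real^'n \<Rightarrow> real) \<Rightarrow> real^'n \<Rightarrow> real^'n^'n" where
  "hessian f x = jacobian (grad f) (at x)"

text \<open>\<^term>\<open>C_k_on k f S\<close> is meant for open \<^term>\<open>S\<close>: all partial derivatives of \<^term>\<open>f\<close> of order
  at most \<^term>\<open>k\<close> exist and are continuous on \<^term>\<open>S\<close>.\<close>

primrec C_k_on :: "nat \<Rightarrow> (real^'n \<Rightarrow> real) \<Rightarrow> (real^'n) set \<Rightarrow> bool" where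
  "C_k_on 0 f S \<longleftrightarrow> continuous_on S f"
| "C_k_on (Suc k) f S \<longleftrightarrow>
     (\<forall>x\<in>S. f differentiable (at x)) \<and> (\<forall>i. C_k_on k (\<lambda>x. grad f x $ i) S)"

definition tensor :: "real^'n^'m \<Rightarrow> real^'p^'m \<Rightarrow> real^'p^'n" (infixl "\<otimes>\<^sub>m" 70) where
  "A \<otimes>\<^sub>m B = transpose A ** B"

text \<open>The same product for vectors, which are read as matrices with a single row.\<close>

definition tensor_vec :: "real^'n \<Rightarrow> real^'p \<Rightarrow> real^'p^'n" (infixl "\<otimes>\<^sub>v" 70) where
  "u \<otimes>\<^sub>v v = (rowvector u :: real^'n^1) \<otimes>\<^sub>m (rowvector v :: real^'p^1)"

text \<open>Upward unit normal to the graph of \<^term>\<open>\<rho>\<close>; the direction of the ray refracted there by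
  Snell's law, \<^term>\<open>\<kappa>\<close> being the ratio of the refractive index above the graph to that below it;
  and the distance along the refracted ray to the horizontal plane at height \<^term>\<open>a\<close>.\<close>

definition unit_normal :: "(real^2 \<Rightarrow> real) \<Rightarrow> real^2 \<Rightarrow> real^3" where
  "unit_normal \<rho> x =
     (1 / sqrt (1 + (norm (grad \<rho> x))\<^sup>2)) *\<^sub>R vector [- grad \<rho> x $ 1, - grad \<rho> x $ 2, 1]"

definition snell_coeff :: "real \<Rightarrow> (real^2 \<Rightarrow> real^3) \<Rightarrow> (real^2 \<Rightarrow> real) \<Rightarrow> real^2 \<Rightarrow> real" where
  "snell_coeff \<kappa> e \<rho> x =
     e x \<bullet> unit_normal \<rho> x - sqrt (\<kappa>\<^sup>2 - 1 + (e x \<bullet> unit_normal \<rho> x)\<^sup>2)"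

definition refracted_dir :: "real \<Rightarrow> (real^2 \<Rightarrow> real^3) \<Rightarrow> (real^2 \<Rightarrow> real) \<Rightarrow> real^2 \<Rightarrow> real^3" where
  "refracted_dir \<kappa> e \<rho> x = (1 / \<kappa>) *\<^sub>R (e x - snell_coeff \<kappa> e \<rho> x *\<^sub>R unit_normal \<rho> x)"

definition refracted_dist ::
    "real \<Rightarrow> real \<Rightarrow> (real^2 \<Rightarrow> real^3) \<Rightarrow> (real^2 \<Rightarrow> real) \<Rightarrow> real^2 \<Rightarrow> real" where
  "refracted_dist a \<kappa> e \<rho> x = (a - \<rho> x) / refracted_dir \<kappa> e \<rho> x $ 3"

definition Delta :: "real \<Rightarrow> (real^2 \<Rightarrow> real) \<Rightarrow> real^2 \<Rightarrow> real" where
  "Delta \<kappa> \<rho> x = sqrt (\<kappa>\<^sup>2 + (\<kappa>\<^sup>2 - 1) * (norm (grad \<rho> x))\<^sup>2)"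

end

theory Submission
  imports Defs
begin

text \<open>Write \<open>p = D\<rho>\<close>, \<open>H = D\<^sup>2\<rho>\<close> and \<open>c = (\<kappa>\<^sup>2 - 1) / (1 + \<Delta>)\<close>. For vertical rays
  \<open>\<lambda> = (1 - \<Delta>) / \<surd>(1 + \<bar>p\<bar>\<^sup>2)\<close>, and since \<open>\<Delta>\<^sup>2 - 1 = (\<kappa>\<^sup>2 - 1)(1 + \<bar>p\<bar>\<^sup>2)\<close> Snell's law becomes
  \<open>\<kappa> m = (- c p, 1 + c)\<close>. As \<open>Dc = - (c\<^sup>2 / \<Delta>) p H\<close>, this gives
  \<open>\<kappa>\<^sup>2 Dm \<otimes> Dm = c\<^sup>2 H\<^sup>t B H\<close> with \<open>B = I - ((\<kappa>\<^sup>2 - 1) / \<Delta>\<^sup>2) p \<otimes> p\<close>, whose inverse is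
  \<open>C = I + ((\<kappa>\<^sup>2 - 1) / \<kappa>\<^sup>2) p \<otimes> p\<close>. All terms with \<open>De\<close> vanish, so the first matrix is
  \<open>c (t H\<^sup>t B - I) H\<close>, where \<open>t = (a - \<rho>)(\<kappa>\<^sup>2 - 1) / (\<kappa>\<^sup>2 + \<Delta>)\<close>, and the transpose of
  \<open>t H\<^sup>t B - I\<close> is \<open>- B (C - t H)\<close>.\<close>

section \<open>Jacobians and Hessians as matrices of derivatives\<close>

lemma has_derivative_matrixI:
  fixes f :: "real^'n \<Rightarrow> real^'m" and J :: "real^'n^'m"
  assumes "\<And>k. ((\<lambda>x. f x $ k) has_derivative (\<lambda>v. J $ k \<bullet> v)) (at x)"
  shows "(f has_derivative (\<lambda>v. J *v v)) (at x)"
  using assms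
  by (subst has_derivative_componentwise_within)
    (auto simp: Basis_vec_def inner_axis matrix_vector_mul_component)

lemma jacobian_eqI:
  fixes f :: "real^'n \<Rightarrow> real^'m"
  assumes "(f has_derivative (\<lambda>v. J *v v)) (at x)"
  shows "jacobian f (at x) = J"
  by (simp add: jacobian_def frechet_derivative_at[OF assms, symmetric])

text \<open>A derivative depends only on values near the point, so constancy on an open set
  suffices. This disposes of \<open>De\<close>, of the derivative of \<open>m De\<close> and of the
  Hessian of \<open>h\<close>, whose underlying maps are prescribed on \<Omega> only.\<close>

lemma jacobian_eq_0:
  fixes f :: "real^'n \<Rightarrow> real^'m"
  assumes "open S" "x \<in> S" "\<And>y. y \<in> S \<Longrightarrow> f y = k"
  shows "jacobian f (at x) = 0"
proof (rule jacobian_eqI)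
  have "((\<lambda>y. k) has_derivative (\<lambda>v. 0 *v v)) (at x)"
    by simp
  then show "(f has_derivative (\<lambda>v. 0 *v v)) (at x)"
    by (rule has_derivative_transform_within_open) (use assms in auto)
qed

text \<open>Unfolding \<open>C_k_on\<close> twice makes each component of the gradient
  differentiable; expanding the argument in the standard basis turns its Frechet derivative into an
  inner product with a row of second partial derivatives.\<close>

lemma grad_has_derivative:
  fixes f :: "real^'n \<Rightarrow> real"
  assumes "C_k_on (Suc (Suc k)) f S" "x \<in> S"
  shows "(grad f has_derivative (\<lambda>v. hessian f x *v v)) (at x)"
proof -
  have "((\<lambda>y. grad f y $ i) has_derivative frechet_derivative (\<lambda>y. grad f y $ i) (at x)) (at x)" for i
    using assms by (simp add: frechet_derivative_works)
  moreover have "frechet_derivative (\<lambda>y. grad f y $ i) (at x) =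
      (\<lambda>v. grad (\<lambda>y. grad f y $ i) x \<bullet> v)" for i
  proof
    fix v :: "real^'n"
    have "linear (frechet_derivative (\<lambda>y. grad f y $ i) (at x))"
      using assms by (simp add: linear_frechet_derivative)
    then have "frechet_derivative (\<lambda>y. grad f y $ i) (at x) (\<Sum>j\<in>UNIV. v $ j *s axis j 1) =
        (\<Sum>j\<in>UNIV. v $ j * grad (\<lambda>y. grad f y $ i) x $ j)"
      by (simp add: linear_sum linear_cmul scalar_mult_eq_scaleR grad_def)
    then show "frechet_derivative (\<lambda>y. grad f y $ i) (at x) v = grad (\<lambda>y. grad f y $ i) x \<bullet> v"
      by (simp add: basis_expansion inner_vec_def mult.commute)
  qed
  ultimately have "(grad f has_derivative (\<lambda>v. (\<chi> i. grad (\<lambda>y. grad f y $ i) x) *v v)) (at x)"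
    by (intro has_derivative_matrixI) simp
  then show ?thesis
    by (simp add: hessian_def jacobian_eqI)
qed

section \<open>Tensor products and vanishing terms\<close>

lemma tensor_vec_component [simp]: "(u \<otimes>\<^sub>v v) $ i $ j = u $ i * v $ j"
  by (simp add: tensor_vec_def tensor_def matrix_matrix_mult_def transpose_def rowvector_def)

lemma zero_tensor [simp]: "0 \<otimes>\<^sub>m A = 0"
  by (simp add: tensor_def transpose_def matrix_matrix_mult_def vec_eq_iff)

lemma tensor_vec_zero [simp]: "u \<otimes>\<^sub>v 0 = 0" "0 \<otimes>\<^sub>v u = 0"
  by (simp_all add: vec_eq_iff)

lemma vector_matrix_mult_0 [simp]: "u v* (0 :: real^'n^'m) = 0"
  by (simp add: vector_matrix_mult_def vec_eq_iff)

section \<open>The refracted direction of vertical rays and its derivative\<close>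

lemma Delta_sq:
  assumes "\<kappa> > 1"
  shows "(Delta \<kappa> \<rho> x)\<^sup>2 = \<kappa>\<^sup>2 + (\<kappa>\<^sup>2 - 1) * (norm (grad \<rho> x))\<^sup>2"
  using assms by (simp add: Delta_def one_le_power)

lemma Delta_pos:
  assumes "\<kappa> > 1"
  shows "Delta \<kappa> \<rho> x > 0"
  using assms by (auto simp: Delta_def one_le_power intro!: add_pos_nonneg)

lemma refracted_dir_vertical:
  fixes \<rho> :: "real^2 \<Rightarrow> real" and x :: "real^2"
  assumes "\<kappa> > 1" "e x = vector [0, 0, 1]"
  defines "c \<equiv> (\<kappa>\<^sup>2 - 1) / (1 + Delta \<kappa> \<rho> x)"
  shows "refracted_dir \<kappa> e \<rho> x =
    (1 / \<kappa>) *\<^sub>R vector [- (c * grad \<rho> x $ 1), - (c * grad \<rho> x $ 2), 1 + c]"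
proof -
  define q where "q = sqrt (1 + (norm (grad \<rho> x))\<^sup>2)"
  define D where "D = Delta \<kappa> \<rho> x"
  have q: "q > 0" "q\<^sup>2 = 1 + (norm (grad \<rho> x))\<^sup>2"
    by (simp_all add: q_def add_pos_nonneg)
  have D: "D > 0" "D\<^sup>2 = 1 + (\<kappa>\<^sup>2 - 1) * q\<^sup>2"
    using Delta_pos[OF assms(1)] Delta_sq[OF assms(1)] by (simp_all add: D_def q algebra_simps)
  have en: "e x \<bullet> unit_normal \<rho> x = 1 / q"
    by (simp add: assms(2) unit_normal_def q_def inner_vec_def sum_3)
  \<comment> \<open>The radicand in \<open>snell_coeff\<close> is a perfect square by the formula
    for the square of \<open>D\<close>; since \<open>D\<close> and \<open>q\<close> are positive,
    its root is \<open>D / q\<close>.\<close>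
  have "\<kappa>\<^sup>2 - 1 + (1 / q)\<^sup>2 = (D / q)\<^sup>2"
    using q(1) by (simp add: D(2) field_simps)
  then have "snell_coeff \<kappa> e \<rho> x = (1 - D) / q"
    using D(1) q(1) by (simp add: snell_coeff_def en diff_divide_distrib)
  moreover have "(1 - D) / q * (1 / q) = - c"
  proof -
    \<comment> \<open>Multiplying by the conjugate \<open>1 + D\<close> cancels the square of
      \<open>q\<close>, so the normalisation of the normal disappears from the refracted
      direction.\<close>
    have "(1 - D) * (1 + D) = - (\<kappa>\<^sup>2 - 1) * q\<^sup>2"
      using D(2) by (simp add: algebra_simps power2_eq_square)
    then show ?thesis
      using q(1) D(1) by (simp add: c_def D_def[symmetric] field_simps power2_eq_square)
  qed
  ultimately have "snell_coeff \<kappa> e \<rho> x *\<^sub>R unit_normal \<rho> x =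
      (- c) *\<^sub>R vector [- grad \<rho> x $ 1, - grad \<rho> x $ 2, 1]"
    by (simp add: unit_normal_def q_def)
  then show ?thesis
    by (simp add: refracted_dir_def assms(2) vec_eq_iff forall_3)
qed

text \<open>The factor depends on the point only through the squared length of the gradient, so the
  chain rule applies to the one-variable function
  \<open>K / (1 + sqrt (\<kappa>\<^sup>2 + K * u))\<close>.\<close>

lemma refraction_factor_has_derivative:
  fixes \<rho> :: "real^2 \<Rightarrow> real"
  assumes "\<kappa> > 1" and grad: "(grad \<rho> has_derivative (\<lambda>v. H *v v)) (at x)"
  defines "c \<equiv> \<lambda>y. (\<kappa>\<^sup>2 - 1) / (1 + Delta \<kappa> \<rho> y)"
  shows "(c has_derivative (\<lambda>v. ((- ((c x)\<^sup>2 / Delta \<kappa> \<rho> x)) *\<^sub>R (grad \<rho> x v* H)) \<bullet> v)) (at x)"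
proof -
  have "Delta \<kappa> \<rho> x > 0"
    using assms(1) by (rule Delta_pos)
  have pos: "\<kappa>\<^sup>2 + (\<kappa>\<^sup>2 - 1) * (grad \<rho> x \<bullet> grad \<rho> x) > 0"
    using \<open>Delta \<kappa> \<rho> x > 0\<close> by (simp add: Delta_def power2_norm_eq_inner)
  define K where "K = \<kappa>\<^sup>2 - 1"
  define r where "r = grad \<rho> x \<bullet> grad \<rho> x"
  define D where "D = Delta \<kappa> \<rho> x"
  \<comment> \<open>Written with an inner product instead of a norm, the inner function is
    differentiable even where the gradient vanishes.\<close>
  have Delta: "Delta \<kappa> \<rho> = (\<lambda>y. sqrt (\<kappa>\<^sup>2 + K * (grad \<rho> y \<bullet> grad \<rho> y)))"
    by (simp add: fun_eq_iff Delta_def K_def power2_norm_eq_inner)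
  have "((\<lambda>u. \<kappa>\<^sup>2 + K * u) has_real_derivative K) (at r)"
    by (auto intro!: derivative_eq_intros)
  moreover have "\<kappa>\<^sup>2 + K * r > 0"
    using pos by (simp add: K_def r_def)
  ultimately have "((\<lambda>u. sqrt (\<kappa>\<^sup>2 + K * u)) has_real_derivative inverse D / 2 * K) (at r)"
    using DERIV_chain2[OF DERIV_real_sqrt, of "\<lambda>u. \<kappa>\<^sup>2 + K * u" r]
    by (simp add: D_def Delta r_def)
  moreover have D: "sqrt (\<kappa>\<^sup>2 + K * r) = D"
    by (simp add: D_def Delta r_def)
  moreover have "1 + D \<noteq> 0"
    using \<open>Delta \<kappa> \<rho> x > 0\<close> by (simp add: D_def)
  ultimately  have "((\<lambda>u. K / (1 + sqrt (\<kappa>\<^sup>2 + K * u))) has_real_derivative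
      (0 * (1 + D) - K * (0 + inverse D / 2 * K)) / ((1 + D) * (1 + D))) (at r)"
    using DERIV_divide[OF DERIV_const[of K] DERIV_add[OF DERIV_const[of 1]],
        of "\<lambda>u. sqrt (\<kappa>\<^sup>2 + K * u)" "inverse D / 2 * K" r UNIV]
    by simp
  \<comment> \<open>The zeros are derivatives of constants in the quotient rule. The remaining
    factor 1/2 cancels the 2 from differentiating the inner product of the gradient with
    itself.\<close>
  also have "(0 * (1 + D) - K * (0 + inverse D / 2 * K)) / ((1 + D) * (1 + D)) =
      - ((c x)\<^sup>2 / D) / 2"
  proof -
    have "D > 0" "c x = K / (1 + D)"
      using \<open>Delta \<kappa> \<rho> x > 0\<close> by (simp_all add: c_def K_def D_def)
    then show ?thesis
      by (simp add: power2_eq_square inverse_eq_divide)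
  qed
  finally have "((\<lambda>y. K / (1 + sqrt (\<kappa>\<^sup>2 + K * (grad \<rho> y \<bullet> grad \<rho> y)))) has_derivative
      (\<lambda>v. (grad \<rho> x \<bullet> (H *v v) + (H *v v) \<bullet> grad \<rho> x) * (- ((c x)\<^sup>2 / D) / 2))) (at x)"
    unfolding r_def by (rule DERIV_compose_FDERIV[OF _ has_derivative_inner[OF grad grad]])
  moreover have "(grad \<rho> x \<bullet> (H *v v) + (H *v v) \<bullet> grad \<rho> x) * (- ((c x)\<^sup>2 / D) / 2) =
      ((- ((c x)\<^sup>2 / D)) *\<^sub>R (grad \<rho> x v* H)) \<bullet> v" for v
    by (simp add: dot_lmul_matrix inner_commute[of "H *v v"] mult.commute)
  ultimately show ?thesis
    unfolding c_def Delta K_def[symmetric] D_def by simp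
qed

text \<open>The product rule is applied to the closed form for vertical rays. That form is valid on
  the open set \<open>S\<close>, hence near \<open>x\<close>, so the derivative carries
  over.\<close>

lemma refracted_dir_has_derivative:
  fixes \<rho> :: "real^2 \<Rightarrow> real"
  assumes "\<kappa> > 1" and grad: "(grad \<rho> has_derivative (\<lambda>v. H *v v)) (at x)"
    and "open S" "x \<in> S" "\<And>y. y \<in> S \<Longrightarrow> e y = vector [0, 0, 1]"
  defines "p \<equiv> grad \<rho> x"
    and "c \<equiv> (\<kappa>\<^sup>2 - 1) / (1 + Delta \<kappa> \<rho> x)"
    and "w \<equiv> grad \<rho> x v* H"
  shows "(refracted_dir \<kappa> e \<rho> has_derivative
    (\<lambda>v. ((1 / \<kappa>) *\<^sub>R vector [(c\<^sup>2 / Delta \<kappa> \<rho> x * p $ 1) *\<^sub>R w - c *\<^sub>R H $ 1,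
      (c\<^sup>2 / Delta \<kappa> \<rho> x * p $ 2) *\<^sub>R w - c *\<^sub>R H $ 2,
      - (c\<^sup>2 / Delta \<kappa> \<rho> x) *\<^sub>R w]) *v v)) (at x)" (is "(_ has_derivative (\<lambda>v. ?J *v v)) _")
proof -
  \<comment> \<open>\<open>c\<close> is a number, the value at \<open>x\<close>; \<open>g\<close> is
    the same factor as a function of the point, which is what gets differentiated.\<close>
  define g where "g = (\<lambda>y. (\<kappa>\<^sup>2 - 1) / (1 + Delta \<kappa> \<rho> y))"
  have gx: "g x = c"
    by (simp add: g_def c_def)
  let ?f = "\<lambda>y. (1 / \<kappa>) *\<^sub>R vector [- (g y * grad \<rho> y $ 1), - (g y * grad \<rho> y $ 2), 1 + g y]
    :: real^3"
  have dc: "(g has_derivative (\<lambda>v. (- (c\<^sup>2 / Delta \<kappa> \<rho> x) *\<^sub>R w) \<bullet> v)) (at x)"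
    using refraction_factor_has_derivative[OF assms(1) grad] by (simp add: c_def g_def w_def)
  have dp: "((\<lambda>y. grad \<rho> y $ i) has_derivative (\<lambda>v. H $ i \<bullet> v)) (at x)" for i
    using bounded_linear.has_derivative[OF bounded_linear_vec_nth grad]
    by (simp add: matrix_vector_mul_component)
  have "((\<lambda>y. ?f y $ k) has_derivative (\<lambda>v. ?J $ k \<bullet> v)) (at x)" for k
  proof -
    have 1: "((\<lambda>y. 1 / \<kappa> * - (g y * grad \<rho> y $ i)) has_derivative
        (\<lambda>v. ((1 / \<kappa>) *\<^sub>R ((c\<^sup>2 / Delta \<kappa> \<rho> x * p $ i) *\<^sub>R w - c *\<^sub>R H $ i)) \<bullet> v)) (at x)" for i
      by (rule has_derivative_eq_rhs,
          rule has_derivative_mult_right[OF has_derivative_minus[OF has_derivative_mult[OF dc dp]]])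
        (simp add: fun_eq_iff p_def gx inner_diff_left algebra_simps)
    have 2: "((\<lambda>y. 1 / \<kappa> * (1 + g y)) has_derivative
        (\<lambda>v. ((1 / \<kappa>) *\<^sub>R (- (c\<^sup>2 / Delta \<kappa> \<rho> x) *\<^sub>R w)) \<bullet> v)) (at x)"
      by (rule has_derivative_eq_rhs,
          rule has_derivative_mult_right[OF has_derivative_add[OF has_derivative_const dc]])
        (simp add: fun_eq_iff)
    show ?thesis
      using exhaust_3[of k] 1[of 1] 1[of 2] 2
      by (elim disjE; simp only: vector_scaleR_component vector_3 real_scaleR_def)
  qed
  then have "(?f has_derivative (\<lambda>v. ?J *v v)) (at x)"
    by (rule has_derivative_matrixI)
  then show ?thesis
    by (rule has_derivative_transform_within_open[OF _ assms(3,4)])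
      (simp add: refracted_dir_vertical[OF assms(1,5)] g_def)
qed

text \<open>Up to the factor \<open>c / \<kappa>\<close>, the rows of the Jacobian are multiples of
  \<open>w = p H\<close>, with a row of \<open>H\<close> subtracted in the first two. Hence the
  product consists of \<open>transpose H ** H\<close> and a multiple of the tensor square of
  \<open>w\<close>.\<close>

lemma jacobian_refracted_dir_tensor:
  fixes \<rho> :: "real^2 \<Rightarrow> real"
  assumes "\<kappa> > 1" and grad: "(grad \<rho> has_derivative (\<lambda>v. H *v v)) (at x)"
    and "open S" "x \<in> S" "\<And>y. y \<in> S \<Longrightarrow> e y = vector [0, 0, 1]"
  defines "c \<equiv> (\<kappa>\<^sup>2 - 1) / (1 + Delta \<kappa> \<rho> x)"
    and "B \<equiv> mat 1 - ((\<kappa>\<^sup>2 - 1) / (Delta \<kappa> \<rho> x)\<^sup>2) *\<^sub>R (grad \<rho> x \<otimes>\<^sub>v grad \<rho> x)"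
  shows "jacobian (refracted_dir \<kappa> e \<rho>) (at x) \<otimes>\<^sub>m jacobian (refracted_dir \<kappa> e \<rho>) (at x) =
    (c\<^sup>2 / \<kappa>\<^sup>2) *\<^sub>R (transpose H ** B ** H)"
proof -
  define p where "p = grad \<rho> x"
  define D where "D = Delta \<kappa> \<rho> x"
  define w where "w = p v* H"
  define K where "K = \<kappa>\<^sup>2 - 1"
  define b where "b = c / D"
  define \<beta> where "\<beta> = K / D\<^sup>2"
  have cb: "c * b = c\<^sup>2 / D"
    by (simp add: b_def power2_eq_square)
  have J: "jacobian (refracted_dir \<kappa> e \<rho>) (at x) = (1 / \<kappa>) *\<^sub>R
     vector [(c * b * p $ 1) *\<^sub>R w - c *\<^sub>R H $ 1, (c * b * p $ 2) *\<^sub>R w - c *\<^sub>R H $ 2, - (c * b) *\<^sub>R w]"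
    unfolding cb unfolding c_def p_def w_def D_def
    by (rule jacobian_eqI[OF refracted_dir_has_derivative[OF assms(1-5)]])
  have D: "D > 0" "D\<^sup>2 = \<kappa>\<^sup>2 + K * (p $ 1 * p $ 1 + p $ 2 * p $ 2)"
    using Delta_pos[OF assms(1)] Delta_sq[OF assms(1)]
    by (simp_all add: D_def p_def K_def power2_norm_eq_inner inner_vec_def sum_2)
  \<comment> \<open>This collapses the coefficient of \<open>w $ i * w $ j\<close>: the quadratic
    term in \<open>b\<close> minus the cross terms \<open>2 * b\<close> leaves
    \<open>- \<beta>\<close>, the coefficient of the rank-one part of \<open>B\<close>. It rests on
    factoring \<open>D\<^sup>2 - 1\<close>.\<close>
  have "b * b * (p $ 1 * p $ 1 + p $ 2 * p $ 2 + 1) = 2 * b - \<beta>"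
  proof -
    have "K * (p $ 1 * p $ 1 + p $ 2 * p $ 2 + 1) = (D + 1) * (D - 1)"
      using D(2) by (simp add: K_def algebra_simps power2_eq_square)
    then have "c * (p $ 1 * p $ 1 + p $ 2 * p $ 2 + 1) = D - 1"
      using D(1) by (simp add: c_def K_def[symmetric] D_def[symmetric] field_simps)
    then have "b * b * (p $ 1 * p $ 1 + p $ 2 * p $ 2 + 1) = c * (D - 1) / D\<^sup>2"
      by (simp add: b_def power2_eq_square)
    moreover have "\<beta> = c * (D + 1) / D\<^sup>2"
    proof -
      have "c * (D + 1) = K"
        using D(1) by (simp add: c_def K_def D_def add.commute)
      then show ?thesis
        by (simp add: \<beta>_def)
    qed
    moreover have "2 * b = c * (2 * D) / D\<^sup>2"
      using D(1) by (simp add: b_def power2_eq_square)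
    moreover have "c * (D - 1) / D\<^sup>2 = c * (2 * D) / D\<^sup>2 - c * (D + 1) / D\<^sup>2"
      by (simp add: diff_divide_distrib[symmetric] algebra_simps)
    ultimately show ?thesis
      by (simp only:)
  qed
  then have b: "b * b * (p $ 1 * p $ 1 + p $ 2 * p $ 2 + 1) * X = (2 * b - \<beta>) * X" for X
    by simp
  have w: "w $ j = p $ 1 * H $ 1 $ j + p $ 2 * H $ 2 $ j" for j
    by (simp add: w_def vector_matrix_mult_def sum_2 mult.commute)
  have "(jacobian (refracted_dir \<kappa> e \<rho>) (at x) \<otimes>\<^sub>m jacobian (refracted_dir \<kappa> e \<rho>) (at x)) $ i $ j =
      ((c\<^sup>2 / \<kappa>\<^sup>2) *\<^sub>R (transpose H ** B ** H)) $ i $ j" for i j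
  proof -
    \<comment> \<open>An entry is the inner product of two columns of the Jacobian. The sums in
      parentheses beside \<open>w $ j\<close> and \<open>w $ i\<close> are again components of
      \<open>w\<close>, so the two cross terms coincide.\<close>
    have "(jacobian (refracted_dir \<kappa> e \<rho>) (at x) \<otimes>\<^sub>m jacobian (refracted_dir \<kappa> e \<rho>) (at x)) $ i $ j =
      c\<^sup>2 / \<kappa>\<^sup>2 * (H $ 1 $ i * H $ 1 $ j + H $ 2 $ i * H $ 2 $ j
        - b * ((p $ 1 * H $ 1 $ i + p $ 2 * H $ 2 $ i) * w $ j
             + w $ i * (p $ 1 * H $ 1 $ j + p $ 2 * H $ 2 $ j))
        + b * b * (p $ 1 * p $ 1 + p $ 2 * p $ 2 + 1) * (w $ i * w $ j))"
      by (simp add: J tensor_def transpose_def matrix_matrix_mult_def sum_3 power2_eq_square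
          add_divide_distrib diff_divide_distrib algebra_simps)
    also have "\<dots> = c\<^sup>2 / \<kappa>\<^sup>2 * (H $ 1 $ i * H $ 1 $ j + H $ 2 $ i * H $ 2 $ j - \<beta> * (w $ i * w $ j))"
      unfolding b w[symmetric] by (simp add: algebra_simps)
    also have "H $ 1 $ i * H $ 1 $ j + H $ 2 $ i * H $ 2 $ j - \<beta> * (w $ i * w $ j) =
        (transpose H ** B ** H) $ i $ j"
      by (simp add: B_def p_def[symmetric] D_def[symmetric] K_def[symmetric] \<beta>_def[symmetric]
          transpose_def matrix_matrix_mult_def sum_2 mat_def w algebra_simps)
    finally show ?thesis
      by simp
  qed
  then show ?thesis
    by (simp add: vec_eq_iff)
qed

section \<open>Matrix algebra and the factorisation of the determinant\<close>

lemma matrix_diff_ldistrib: "A ** (B - C) = A ** B - A ** (C :: real^'n^'m)"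
  by (simp add: matrix_matrix_mult_def vec_eq_iff right_diff_distrib sum_subtractf)

lemma matrix_diff_rdistrib: "(A - B) ** C = A ** C - B ** (C :: real^'n^'m)"
  by (simp add: matrix_matrix_mult_def vec_eq_iff left_diff_distrib sum_subtractf)

lemma scaleR_eq_mat_mult: "k *\<^sub>R A = mat k ** (A :: real^'n^'n)"
  by (simp add: mat_def vec_eq_iff matrix_matrix_mult_def if_distrib[of "\<lambda>u. u * _"] cong: if_cong)

lemma det_scaleR: "det (k *\<^sub>R A) = k ^ CARD('n) * det (A :: real^'n^'n)"
  by (metis det_matrix_scaleR det_mul matrix_scaleR scaleR_eq_mat_mult)

text \<open>The square of \<open>p \<otimes>\<^sub>v p\<close> is \<open>p \<bullet> p\<close> times
  itself, so the product is the identity plus a multiple of this matrix; the hypothesis says that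
  the multiple is zero. This is a case of the Sherman-Morrison formula.\<close>

lemma rank_one_update_inverse:
  fixes p :: "real^'n"
  assumes "\<alpha> - \<beta> = \<alpha> * \<beta> * (p \<bullet> p)"
  shows "(mat 1 - \<beta> *\<^sub>R (p \<otimes>\<^sub>v p)) ** (mat 1 + \<alpha> *\<^sub>R (p \<otimes>\<^sub>v p)) = mat 1"
proof -
  have "(p \<otimes>\<^sub>v p) ** (p \<otimes>\<^sub>v p) = (p \<bullet> p) *\<^sub>R (p \<otimes>\<^sub>v p)"
    by (simp add: vec_eq_iff matrix_matrix_mult_def inner_vec_def sum_distrib_right sum_distrib_left
        mult_ac)
  then have "(mat 1 - \<beta> *\<^sub>R (p \<otimes>\<^sub>v p)) ** (mat 1 + \<alpha> *\<^sub>R (p \<otimes>\<^sub>v p)) =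
      mat 1 + (\<alpha> - \<beta> - \<alpha> * \<beta> * (p \<bullet> p)) *\<^sub>R (p \<otimes>\<^sub>v p)"
    by (simp add: matrix_add_ldistrib matrix_diff_rdistrib matrix_scalar_ac
        scalar_matrix_assoc[symmetric] algebra_simps)
  then show ?thesis
    using assms by simp
qed

text \<open>\<open>H\<close> splits off on the right. Transposing the other factor turns
  \<open>transpose H ** B\<close> into \<open>B ** H\<close>, so that \<open>B\<close> splits off on
  the left, and \<open>det B\<close> is nonzero because \<open>B\<close> is invertible.\<close>

lemma det_factor:
  fixes H B C :: "real^'n^'n"
  assumes "c \<noteq> 0" "B ** C = mat 1" "transpose B = B"
  shows "det ((- c) *\<^sub>R H + (c * t) *\<^sub>R (transpose H ** B ** H)) \<noteq> 0 \<longleftrightarrow>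
    det H \<noteq> 0 \<and> det (C - t *\<^sub>R H) \<noteq> 0"
proof -
  let ?N = "t *\<^sub>R (transpose H ** B) - mat 1"
  have "(- c) *\<^sub>R H + (c * t) *\<^sub>R (transpose H ** B ** H) = c *\<^sub>R (?N ** H)"
    by (simp add: matrix_diff_rdistrib scalar_matrix_assoc[symmetric] scaleR_diff_right)
  moreover have "transpose ?N = (- 1) *\<^sub>R (B ** (C - t *\<^sub>R H))"
  proof -
    have "transpose ?N = t *\<^sub>R (B ** H) - mat 1"
      using assms(3) by (simp add: transpose_def vec_eq_iff matrix_matrix_mult_def mat_def mult.commute)
    then show ?thesis
      by (simp add: matrix_diff_ldistrib matrix_scalar_ac scalar_matrix_assoc[symmetric] assms(2))
  qed
  then have "det ?N = (- 1) ^ CARD('n) * (det B * det (C - t *\<^sub>R H))"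
    by (metis det_mul det_scaleR det_transpose)
  moreover have "det B \<noteq> 0"
    using arg_cong[OF assms(2), of det] by (auto simp: det_mul)
  ultimately show ?thesis
    using assms(1) by (auto simp: det_scaleR det_mul)
qed

section \<open>Equivalence of the two conditions\<close>

theorem theorem3p6:
  fixes \<Omega> :: "(real^2) set" and a \<kappa>\<^sub>1 :: real and x\<^sub>0 :: "real^2"
    and \<rho> h d :: "real^2 \<Rightarrow> real" and e m :: "real^2 \<Rightarrow> real^3"
  assumes "open \<Omega>" and "connected \<Omega>" and "a > 0" and "\<kappa>\<^sub>1 > 1" and "x\<^sub>0 \<in> \<Omega>"
    and "C_k_on 3 \<rho> \<Omega>" and "\<And>x. x \<in> \<Omega> \<Longrightarrow> 0 < \<rho> x \<and> \<rho> x < a"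
    and "\<And>x. x \<in> \<Omega> \<Longrightarrow> e x = vector [0, 0, 1]"
    and "\<And>x. x \<in> \<Omega> \<Longrightarrow> m x = refracted_dir \<kappa>\<^sub>1 e \<rho> x"
    and "\<And>x. x \<in> \<Omega> \<Longrightarrow> d x = refracted_dist a \<kappa>\<^sub>1 e \<rho> x"
    and "\<And>x. x \<in> \<Omega> \<Longrightarrow> h differentiable (at x) \<and> grad h x = vector [e x $ 1, e x $ 2]"
  shows
    "det (hessian h x\<^sub>0
          + (1 - \<kappa>\<^sub>1 * (e x\<^sub>0 \<bullet> m x\<^sub>0)) *\<^sub>R hessian \<rho> x\<^sub>0
          - \<kappa>\<^sub>1 *\<^sub>R (grad \<rho> x\<^sub>0 \<otimes>\<^sub>v (m x\<^sub>0 v* jacobian e (at x\<^sub>0))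
                  + (m x\<^sub>0 v* jacobian e (at x\<^sub>0)) \<otimes>\<^sub>v grad \<rho> x\<^sub>0)
          - (\<kappa>\<^sub>1 * \<rho> x\<^sub>0) *\<^sub>R (jacobian (\<lambda>x. m x v* jacobian e (at x)) (at x\<^sub>0)
                          - jacobian e (at x\<^sub>0) \<otimes>\<^sub>m jacobian m (at x\<^sub>0))
          + (\<kappa>\<^sub>1 * d x\<^sub>0) *\<^sub>R (jacobian m (at x\<^sub>0) \<otimes>\<^sub>m jacobian m (at x\<^sub>0))) \<noteq> 0
     \<longleftrightarrow>
     det (hessian \<rho> x\<^sub>0) \<noteq> 0 \<and>
     det (mat 1
          + ((\<kappa>\<^sub>1\<^sup>2 - 1) / \<kappa>\<^sub>1\<^sup>2) *\<^sub>R (grad \<rho> x\<^sub>0 \<otimes>\<^sub>v grad \<rho> x\<^sub>0)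
          + ((a - \<rho> x\<^sub>0) * (1 - \<kappa>\<^sub>1\<^sup>2) / (\<kappa>\<^sub>1\<^sup>2 + Delta \<kappa>\<^sub>1 \<rho> x\<^sub>0)) *\<^sub>R hessian \<rho> x\<^sub>0) \<noteq> 0"
proof -
  let ?D = "Delta \<kappa>\<^sub>1 \<rho> x\<^sub>0"
  define p where "p = grad \<rho> x\<^sub>0"
  define H where "H = hessian \<rho> x\<^sub>0"
  define c where "c = (\<kappa>\<^sub>1\<^sup>2 - 1) / (1 + ?D)"
  define t where "t = (a - \<rho> x\<^sub>0) * (\<kappa>\<^sub>1\<^sup>2 - 1) / (\<kappa>\<^sub>1\<^sup>2 + ?D)"
  define B where "B = mat 1 - ((\<kappa>\<^sub>1\<^sup>2 - 1) / ?D\<^sup>2) *\<^sub>R (p \<otimes>\<^sub>v p)"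
  define C where "C = mat 1 + ((\<kappa>\<^sub>1\<^sup>2 - 1) / \<kappa>\<^sub>1\<^sup>2) *\<^sub>R (p \<otimes>\<^sub>v p)"
  have D: "?D > 0" "?D\<^sup>2 = \<kappa>\<^sub>1\<^sup>2 + (\<kappa>\<^sub>1\<^sup>2 - 1) * (p \<bullet> p)"
    using Delta_pos Delta_sq assms(4) by (auto simp: p_def power2_norm_eq_inner)
  have \<kappa>: "\<kappa>\<^sub>1\<^sup>2 > 1"
    using assms(4) by (simp add: one_less_power)
  then have "c > 0"
    using D(1) by (simp add: c_def)
  have grad: "(grad \<rho> has_derivative (\<lambda>v. H *v v)) (at x\<^sub>0)"
    unfolding H_def using assms(5,6) by (intro grad_has_derivative[of 1]) (simp_all add: numeral_3_eq_3)
  \<comment> \<open>Stated on all of \<Omega>, since differentiating \<open>m De\<close> at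
    \<open>x\<^sub>0\<close> involves nearby points.\<close>
  have De: "jacobian e (at x) = 0" if "x \<in> \<Omega>" for x
    using jacobian_eq_0[OF assms(1) that] assms(8) by blast
  have Dme: "jacobian (\<lambda>x. m x v* jacobian e (at x)) (at x\<^sub>0) = 0"
    by (rule jacobian_eq_0[OF assms(1,5)]) (simp add: De)
  have h: "hessian h x\<^sub>0 = 0"
    unfolding hessian_def
    by (rule jacobian_eq_0[OF assms(1,5), of _ 0])
      (use assms(8,11) in \<open>simp add: vec_eq_iff forall_2\<close>)
  \<comment> \<open>\<open>m\<close> agrees with \<open>refracted_dir\<close> only on \<Omega>, so
    the Jacobian is transferred through a derivative on an open set, not by equality of
    functions.\<close>
  have "(m has_derivative (\<lambda>v. jacobian (refracted_dir \<kappa>\<^sub>1 e \<rho>) (at x\<^sub>0) *v v)) (at x\<^sub>0)"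
  proof (rule has_derivative_transform_within_open[OF _ assms(1,5)])
    show "(refracted_dir \<kappa>\<^sub>1 e \<rho> has_derivative
        (\<lambda>v. jacobian (refracted_dir \<kappa>\<^sub>1 e \<rho>) (at x\<^sub>0) *v v)) (at x\<^sub>0)"
      using differentiableI[OF refracted_dir_has_derivative[where e = e, OF assms(4) grad assms(1,5,8)]]
      by (simp add: jacobian_works)
  qed (simp add: assms(9))
  then have Dm: "jacobian m (at x\<^sub>0) \<otimes>\<^sub>m jacobian m (at x\<^sub>0) =
      (c\<^sup>2 / \<kappa>\<^sub>1\<^sup>2) *\<^sub>R (transpose H ** B ** H)"
    using jacobian_refracted_dir_tensor[where e = e, OF assms(4) grad assms(1,5,8)]
    by (simp add: jacobian_eqI c_def B_def p_def)
  have m3: "m x\<^sub>0 $ 3 = (1 + c) / \<kappa>\<^sub>1"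
    using refracted_dir_vertical[where \<rho> = \<rho> and x = x\<^sub>0 and e = e, OF assms(4) assms(8)] assms(5,9)
    by (simp add: c_def)
  have em: "1 - \<kappa>\<^sub>1 * (e x\<^sub>0 \<bullet> m x\<^sub>0) = - c"
    using assms(4,5,8) m3 by (simp add: inner_vec_def sum_3)
  \<comment> \<open>With \<open>m3\<close>, the left side is
    \<open>(a - \<rho> x\<^sub>0) * c\<^sup>2 / (1 + c)\<close>; the quotient
    \<open>c / (1 + c)\<close> brings in the denominator
    \<open>\<kappa>\<^sub>1\<^sup>2 + ?D\<close> of \<open>t\<close>.\<close>
  have coeff: "\<kappa>\<^sub>1 * d x\<^sub>0 * (c\<^sup>2 / \<kappa>\<^sub>1\<^sup>2) = c * t"
  proof -
    have "d x\<^sub>0 = (a - \<rho> x\<^sub>0) / ((1 + c) / \<kappa>\<^sub>1)"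
      using m3 assms(5,9,10) by (simp add: refracted_dist_def)
    then have "\<kappa>\<^sub>1 * d x\<^sub>0 * (c\<^sup>2 / \<kappa>\<^sub>1\<^sup>2) = c * ((a - \<rho> x\<^sub>0) * (c / (1 + c)))"
      using assms(4) by (simp add: power2_eq_square)
    also have "c / (1 + c) = (\<kappa>\<^sub>1\<^sup>2 - 1) / (\<kappa>\<^sub>1\<^sup>2 + ?D)"
    proof -
      have "1 + c = (\<kappa>\<^sub>1\<^sup>2 + ?D) / (1 + ?D)"
        using D(1) by (simp add: c_def field_simps)
      then show ?thesis
        using D(1) by (simp add: c_def)
    qed
    finally show ?thesis
      by (simp add: t_def)
  qed
  have "B ** C = mat 1"
    unfolding B_def C_def
  proof (rule rank_one_update_inverse)
    define K where "K = \<kappa>\<^sub>1\<^sup>2 - 1"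
    \<comment> \<open>The inverse condition amounts to the formula for \<open>?D\<^sup>2\<close>,
      read as a value for \<open>?D\<^sup>2 - \<kappa>\<^sub>1\<^sup>2\<close>.\<close>
    have "K / \<kappa>\<^sub>1\<^sup>2 - K / ?D\<^sup>2 = K * (?D\<^sup>2 - \<kappa>\<^sub>1\<^sup>2) / (\<kappa>\<^sub>1\<^sup>2 * ?D\<^sup>2)"
      using D(1) assms(4) by (simp add: field_simps)
    also have "?D\<^sup>2 - \<kappa>\<^sub>1\<^sup>2 = K * (p \<bullet> p)"
      by (simp add: D(2) K_def)
    finally show "(\<kappa>\<^sub>1\<^sup>2 - 1) / \<kappa>\<^sub>1\<^sup>2 - (\<kappa>\<^sub>1\<^sup>2 - 1) / ?D\<^sup>2 =
        (\<kappa>\<^sub>1\<^sup>2 - 1) / \<kappa>\<^sub>1\<^sup>2 * ((\<kappa>\<^sub>1\<^sup>2 - 1) / ?D\<^sup>2) * (p \<bullet> p)"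
      by (simp add: K_def)
  qed
  moreover have "transpose B = B"
    by (simp add: B_def transpose_def vec_eq_iff mat_def mult.commute)
  ultimately have "det ((- c) *\<^sub>R H + (c * t) *\<^sub>R (transpose H ** B ** H)) \<noteq> 0 \<longleftrightarrow>
      det H \<noteq> 0 \<and> det (C - t *\<^sub>R H) \<noteq> 0"
    using \<open>c > 0\<close> by (intro det_factor; simp)
  \<comment> \<open>The target has \<open>1 - \<kappa>\<^sub>1\<^sup>2\<close> where
    \<open>t\<close> has the opposite sign, so its matrix is
    \<open>C - t *\<^sub>R H\<close>.\<close>
  moreover have neg_t: "(a - \<rho> x\<^sub>0) * (1 - \<kappa>\<^sub>1\<^sup>2) / (\<kappa>\<^sub>1\<^sup>2 + ?D) = - t"
    unfolding t_def minus_divide_left by (simp add: algebra_simps)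
  ultimately show ?thesis
    unfolding h em Dme De[OF assms(5)] Dm scaleR_scaleR coeff neg_t
    by (simp add: C_def p_def H_def)
qed

end
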